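(* Let $U_1,\dots,U_m$ ($m\ge1$) be affine subspaces of $\mathbb{R}^n$ with nonempty intersection $S=\bigcap_{i=1}^m U_i$, and let $x\in\mathbb{R}^n$ be given. Then the P-CRM sequence $(C_P^k(x))_k$ converges linearly to $s^\star=P_S(x)$, the projection of the initial point $x$ onto $S$.
   Context: $\mathbb{R}^n$ carries its standard inner product and Euclidean norm. For a nonempty closed convex set $C\subset\mathbb{R}^n$, $P_C(x)$ denotes the unique point of $C$ nearest to $x$, and $R_C(x)=2P_C(x)-x$ is the reflection of $x$ with respect to $C$. For $x\in\mathbb{R}^n$, let $W_x=\mathrm{aff}\{x,R_{U_1}(x),\dots,R_{U_m}(x)\}$ (affine hull). $C_P(x)$ denotes the circumcenter of $x,R_{U_1}(x),\dots,R_{U_m}(x)$, i.e. the point of $\mathbb{R}^n$ such that (P1) $C_P(x)\in W_x$, and (P2) $C_P(x)$ is equidistant to $x,R_{U_1}(x),\dots,R_{U_m}(x)$; since $S\ne\emptyset$, such a point exists and is unique. The P-CRM (Parallelized Circumcentered Reflection Method) sequence is $C_P^0(x)=x$, $C_P^k(x)=C_P(C_P^{k-1}(x))$ for $k\ge1$. A sequence $(x_k)_k$ converges linearly to $s^\star$ if there is $r\in[0,1)$ with $\|x_{k+1}-s^\star\|\le r\|x_k-s^\star\|$ for all $k\ge0$. *)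

theory Defs
  imports "HOL-Analysis.Analysis"
begin

definition set_reflection :: "'a::euclidean_space set \<Rightarrow> 'a \<Rightarrow> 'a" where
  "set_reflection C x = 2 *\<^sub>R closest_point C x - x"

text \<open>
  The description below is proper only if exactly one such point exists. Uniqueness is
  automatic; existence is not (take three distinct collinear points). For the point sets
  used here see \<open>P_CRM_pts_circumcenter_ex1\<close>.
\<close>

definition circumcenter :: "'a::euclidean_space set \<Rightarrow> 'a" where
  "circumcenter A = (THE p. p \<in> affine hull A \<and> (\<forall>a\<in>A. \<forall>b\<in>A. dist p a = dist p b))"

definition P_CRM_pts :: "(nat \<Rightarrow> 'a::euclidean_space set) \<Rightarrow> nat \<Rightarrow> 'a \<Rightarrow> 'a set" where
  "P_CRM_pts U m x = insert x ((\<lambda>i. set_reflection (U i) x) ` {1..m})"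

definition P_CRM :: "(nat \<Rightarrow> 'a::euclidean_space set) \<Rightarrow> nat \<Rightarrow> 'a \<Rightarrow> 'a" where
  "P_CRM U m x = circumcenter (P_CRM_pts U m x)"

definition converges_linearly :: "(nat \<Rightarrow> 'a::real_normed_vector) \<Rightarrow> 'a \<Rightarrow> bool" where
  "converges_linearly X s \<longleftrightarrow>
     (\<exists>r::real. 0 \<le> r \<and> r < 1 \<and> (\<forall>k. norm (X (Suc k) - s) \<le> r * norm (X k - s)))"

lemma affine_closest_point_orthogonal:
  fixes W :: "'a::euclidean_space set"
  assumes "affine W" "a \<in> W"
  shows "(x - closest_point W x) \<bullet> (a - closest_point W x) = 0"
proof -
  let ?p = "closest_point W x"
  have cl: "closed W" "convex W"
    using assms by (auto simp: affine_closed affine_imp_convex)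
  have p: "?p \<in> W" using assms cl by (auto intro: closest_point_in_set)
  have b: "2 *\<^sub>R ?p - a \<in> W"
    using mem_affine[OF assms(1) p assms(2), of 2 "-1"] by simp
  have "(x - ?p) \<bullet> (a - ?p) \<le> 0" "(x - ?p) \<bullet> ((2 *\<^sub>R ?p - a) - ?p) \<le> 0"
    using closest_point_dot[OF cl(2,1)] assms b by blast+
  moreover have "(2 *\<^sub>R ?p - a) - ?p = - (a - ?p)" by (simp add: scaleR_2)
  ultimately show ?thesis by (metis inner_minus_right neg_le_0_iff_le order_antisym)
qed

lemma dist_set_reflection:
  fixes W :: "'a::euclidean_space set"
  assumes "affine W" "s \<in> W"
  shows "dist s (set_reflection W x) = dist s x"
proof -
  let ?p = "closest_point W x"
  have o: "(x - ?p) \<bullet> (s - ?p) = 0"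
    using affine_closest_point_orthogonal[OF assms] .
  have "norm ((s - ?p) + (x - ?p)) = norm ((s - ?p) - (x - ?p))"
    using o by (simp only: norm_eq inner_add_left inner_add_right inner_diff_left
        inner_diff_right inner_commute)
  moreover have "s - set_reflection W x = (s - ?p) + (x - ?p)"
    by (simp add: set_reflection_def scaleR_2)
  moreover have "s - x = (s - ?p) - (x - ?p)" by simp
  ultimately show ?thesis by (simp only: dist_norm)
qed

lemma P_CRM_pts_circumcenter_ex1:
  fixes U :: "nat \<Rightarrow> 'a::euclidean_space set"
  assumes "\<And>i. i \<in> {1..m} \<Longrightarrow> affine (U i)" and "(\<Inter>i\<in>{1..m}. U i) \<noteq> {}"
  shows "\<exists>!p. p \<in> affine hull P_CRM_pts U m x \<and>
           (\<forall>a\<in>P_CRM_pts U m x. \<forall>b\<in>P_CRM_pts U m x. dist p a = dist p b)"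
proof -
  let ?A = "P_CRM_pts U m x"
  let ?W = "affine hull ?A"
  obtain s where s: "\<And>i. i \<in> {1..m} \<Longrightarrow> s \<in> U i" using assms(2) by blast
  let ?p = "closest_point ?W s"
  have ne: "?W \<noteq> {}" by (simp add: P_CRM_pts_def)
  have ds: "dist s a = dist s x" if "a \<in> ?A" for a
    using that assms(1) s dist_set_reflection unfolding P_CRM_pts_def by blast
  have pd: "(dist ?p a)\<^sup>2 = (dist s x)\<^sup>2 - (dist s ?p)\<^sup>2" if "a \<in> ?A" for a
  proof -
    have "a \<in> ?W" using that hull_subset by fastforce
    then have "(s - ?p) \<bullet> (a - ?p) = 0"
      using affine_closest_point_orthogonal[of ?W a s] by simp
    then have "(dist s a)\<^sup>2 = (dist s ?p)\<^sup>2 + (dist ?p a)\<^sup>2"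
      by (simp add: dist_norm power2_norm_eq_inner inner_diff inner_commute algebra_simps)
    then show ?thesis using ds[OF that] by simp
  qed
  show ?thesis
  proof (rule ex1I[of _ ?p], intro conjI ballI)
    show "?p \<in> ?W" using ne by (simp add: closest_point_in_set)
    show "dist ?p a = dist ?p b" if "a \<in> ?A" "b \<in> ?A" for a b
      using pd[OF that(1)] pd[OF that(2)] by (metis power2_eq_imp_eq zero_le_dist)
  next
    fix q assume q: "q \<in> ?W \<and> (\<forall>a\<in>?A. \<forall>b\<in>?A. dist q a = dist q b)"
    have x: "x \<in> ?A" by (simp add: P_CRM_pts_def)
    let ?d = "q - ?p"
    let ?H = "{y. ?d \<bullet> y = ?d \<bullet> x}"
    have "?A \<subseteq> ?H"
    proof
      fix a assume a: "a \<in> ?A"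
      have "(dist q a)\<^sup>2 = (dist q x)\<^sup>2" using q a x by metis
      moreover have "(dist ?p a)\<^sup>2 = (dist ?p x)\<^sup>2" using pd[OF a] pd[OF x] by simp
      ultimately show "a \<in> ?H"
        by (simp add: dist_norm power2_norm_eq_inner inner_diff inner_commute algebra_simps)
    qed
    then have "?W \<subseteq> ?H" by (intro hull_minimal) (auto simp: affine_hyperplane)
    moreover have "?p \<in> ?W" using ne by (simp add: closest_point_in_set)
    ultimately have "q \<in> ?H" "?p \<in> ?H" using q by (meson subsetD)+
    then have "?d \<bullet> q = ?d \<bullet> ?p" by simp
    then have "?d \<bullet> ?d = 0" by (simp add: inner_diff_right)
    then show "q = ?p" by simp
  qed
qed

end

theory Submission
  imports Defs
begin

text \<open>
  Every \<open>s \<in> S\<close> is equidistant from the points \<open>x, R\<^sub>1 x, \<dots>, R\<^sub>m x\<close>, so the circumcenter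
  \<open>C x\<close> is the projection of every \<open>s \<in> S\<close> onto \<open>W\<^sub>x\<close>. Hence \<open>x - C x\<close> is orthogonal to the
  directions of \<open>S\<close>, and the projection onto \<open>S\<close> is constant along the iteration. Moreover, since
  \<open>P\<^sub>i x \<in> W\<^sub>x\<close>, the point \<open>C x\<close> is at least as close to \<open>s\<close> as \<open>P\<^sub>i x\<close> is, so the squared
  distance to \<open>s\<close> drops by at least \<open>d(x, U\<^sub>i)\<^sup>2\<close> for each \<open>i\<close>. By compactness and homogeneity,
  \<open>\<Sum>\<^sub>i d(x, U\<^sub>i)\<^sup>2\<close> is at least a fixed positive multiple of \<open>d(x, S)\<^sup>2\<close>, which yields a uniform
  contraction factor.
\<close>

lemma closest_point_affine_eqI:
  fixes W :: "'a::euclidean_space set"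
  assumes "affine W" "p \<in> W" and o: "\<And>a. a \<in> W \<Longrightarrow> (x - p) \<bullet> (a - p) = 0"
  shows "closest_point W x = p"
proof -
  let ?q = "closest_point W x"
  have q: "?q \<in> W"
    using assms(1,2) affine_closed by (auto intro: closest_point_in_set)
  have "(x - ?q) \<bullet> (p - ?q) = 0" "(x - p) \<bullet> (?q - p) = 0"
    using affine_closest_point_orthogonal[OF assms(1,2)] o[OF q] by auto
  then have "(?q - p) \<bullet> (?q - p) = 0"
    by (simp add: algebra_simps inner_commute)
  then show ?thesis by simp
qed

lemma dist_affine_closest_point_Pythagoras:
  fixes W :: "'a::euclidean_space set"
  assumes "affine W" "a \<in> W"
  shows "(dist x a)\<^sup>2 = (dist x (closest_point W x))\<^sup>2 + (dist (closest_point W x) a)\<^sup>2"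
  using affine_closest_point_orthogonal[OF assms, of x]
  by (simp add: dist_norm power2_norm_eq_inner inner_diff inner_commute algebra_simps)

text \<open>With \<open>s\<close> as origin, \<open>W\<close> is a linear subspace and its
  projection is a linear map. This makes squared distances to \<open>W\<close> homogeneous of degree
  two.\<close>

lemma closest_point_affine_scale:
  fixes W :: "'a::euclidean_space set"
  assumes "affine W" "s \<in> W"
  shows "closest_point W (s + t *\<^sub>R v) = s + t *\<^sub>R (closest_point W (s + v) - s)"
proof (rule closest_point_affine_eqI[OF assms(1)])
  let ?q = "closest_point W (s + v)"
  have q: "?q \<in> W"
    using assms affine_closed by (auto intro: closest_point_in_set)
  show "s + t *\<^sub>R (?q - s) \<in> W"
    using mem_affine[OF assms q, of "1 - t" t] by (simp add: algebra_simps)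
  fix a assume a: "a \<in> W"
  have "(s + v - ?q) \<bullet> (a - ?q) = 0" "(s + v - ?q) \<bullet> (s - ?q) = 0"
    using affine_closest_point_orthogonal[OF assms(1)] a assms(2) by blast+
  moreover have "a - (s + t *\<^sub>R (?q - s)) = (a - ?q) - (1 - t) *\<^sub>R (s - ?q)"
    by (simp add: algebra_simps)
  moreover have "s + t *\<^sub>R v - (s + t *\<^sub>R (?q - s)) = t *\<^sub>R (s + v - ?q)"
    by (simp add: algebra_simps)
  ultimately show "(s + t *\<^sub>R v - (s + t *\<^sub>R (?q - s))) \<bullet> (a - (s + t *\<^sub>R (?q - s))) = 0"
    by (simp only: inner_scaleR_left inner_scaleR_right inner_diff_right) simp
qed

text \<open>The sum vanishes along the whole intersection, so a lower bound is possible only for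
  \<open>v\<close> normal to it; there \<open>c\<close> is the minimum over unit vectors.\<close>

lemma affine_family_linear_regularity:
  fixes U :: "'i \<Rightarrow> 'a::euclidean_space set"
  assumes "finite I" and aff: "\<And>i. i \<in> I \<Longrightarrow> affine (U i)" and s: "\<And>i. i \<in> I \<Longrightarrow> s \<in> U i"
  shows "\<exists>c>0. \<forall>v. (\<forall>t\<in>\<Inter>i\<in>I. U i. v \<bullet> (t - s) = 0) \<longrightarrow>
           c * (norm v)\<^sup>2 \<le> (\<Sum>i\<in>I. (dist (s + v) (closest_point (U i) (s + v)))\<^sup>2)"
proof -
  let ?N = "{v. \<forall>t\<in>\<Inter>i\<in>I. U i. v \<bullet> (t - s) = 0}"
  let ?K = "sphere 0 1 \<inter> ?N"
  define g where "g = (\<lambda>v. \<Sum>i\<in>I. (dist (s + v) (closest_point (U i) (s + v)))\<^sup>2)"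
  have cl: "closed (U i)" "convex (U i)" "U i \<noteq> {}" if "i \<in> I" for i
    using affine_closed[OF aff[OF that]] affine_imp_convex[OF aff[OF that]] s[OF that] by blast+
  have scale: "g (t *\<^sub>R v) = t\<^sup>2 * g v" for t v
  proof -
    have "(dist (s + t *\<^sub>R v) (closest_point (U i) (s + t *\<^sub>R v)))\<^sup>2
        = t\<^sup>2 * (dist (s + v) (closest_point (U i) (s + v)))\<^sup>2" if "i \<in> I" for i
    proof -
      let ?q = "closest_point (U i) (s + v)"
      have "s + t *\<^sub>R v - closest_point (U i) (s + t *\<^sub>R v) = t *\<^sub>R (s + v - ?q)"
        unfolding closest_point_affine_scale[OF aff[OF that] s[OF that]]
        by (simp add: algebra_simps)
      then show ?thesis by (simp add: dist_norm power_mult_distrib)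
    qed
    then show ?thesis by (simp add: g_def sum_distrib_left)
  qed
  have pos: "g v > 0" if "v \<in> ?K" for v
  proof (rule ccontr)
    assume "\<not> g v > 0"
    moreover have "g v \<ge> 0" by (simp add: g_def sum_nonneg)
    ultimately have "g v = 0" by simp
    then have z: "closest_point (U i) (s + v) = s + v" if "i \<in> I" for i
      using that assms(1) by (auto simp: g_def sum_nonneg_eq_0_iff)
    have "s + v \<in> U i" if "i \<in> I" for i
      using z[OF that] cl[OF that] closest_point_in_set by metis
    \<comment> \<open>Since \<open>s + v\<close> lies in every \<open>U i\<close>, it may serve as
      \<open>t\<close>, so \<open>v\<close> is orthogonal to itself.\<close>
    then have "v \<bullet> (s + v - s) = 0" using that by blast
    then show False using that by simp
  qed
  have "closed ?N"
  proof -
    have "?N = (\<Inter>t\<in>\<Inter>i\<in>I. U i. {v. (t - s) \<bullet> v = 0})" by (auto simp: inner_commute)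
    then show ?thesis by (simp only:) (intro closed_INT ballI closed_hyperplane)
  qed
  then have comp: "compact ?K" by (intro compact_Int_closed compact_sphere)
  have cont: "continuous_on ?K g"
    unfolding g_def
  proof (intro continuous_intros)
    fix i assume i: "i \<in> I"
    show "continuous_on ?K (\<lambda>v. closest_point (U i) (s + v))"
      by (rule continuous_on_compose2[OF continuous_on_closest_point[OF cl(2,1,3)[OF i], of UNIV]])
        (auto intro: continuous_intros)
  qed
  obtain c where c: "c > 0" "\<And>v. v \<in> ?K \<Longrightarrow> c \<le> g v"
  proof (cases "?K = {}")
    case True
    \<comment> \<open>This occurs when the intersection is the whole space; any positive constant
      then works.\<close>
    then show ?thesis using that[of 1] by auto
  next
    case False
    then show ?thesis
      using continuous_attains_inf[OF comp False cont] pos that by blast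
  qed
  have "c * (norm v)\<^sup>2 \<le> g v" if "v \<in> ?N" for v
  proof (cases "v = 0")
    case True
    then show ?thesis by (simp add: g_def sum_nonneg)
  next
    case False
    then have "v /\<^sub>R norm v \<in> ?K" using that by simp
    then have "c \<le> g (v /\<^sub>R norm v)" by (rule c)
    also have "\<dots> = g v / (norm v)\<^sup>2" by (simp add: scale power_inverse divide_inverse mult.commute)
    finally show ?thesis using False by (simp add: field_simps)
  qed
  then show ?thesis using c(1) unfolding g_def by blast
qed

locale affine_family =
  fixes U :: "nat \<Rightarrow> 'a::euclidean_space set" and m :: nat
  assumes affine_U: "\<And>i. i \<in> {1..m} \<Longrightarrow> affine (U i)"
    and Inter_nonempty: "(\<Inter>i\<in>{1..m}. U i) \<noteq> {}"
begin

lemma P_CRM_circumcenter: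
  shows P_CRM_in_hull: "P_CRM U m x \<in> affine hull P_CRM_pts U m x"
    and P_CRM_equidistant:
      "\<lbrakk>a \<in> P_CRM_pts U m x; b \<in> P_CRM_pts U m x\<rbrakk> \<Longrightarrow> dist (P_CRM U m x) a = dist (P_CRM U m x) b"
  using theI'[OF P_CRM_pts_circumcenter_ex1[of m U x, OF affine_U Inter_nonempty]]
  unfolding P_CRM_def circumcenter_def by blast+

text \<open>
  Both \<open>s\<close> and \<open>C x\<close> are equidistant from the reflected points, so these points lie on a
  hyperplane normal to \<open>s - C x\<close>, which then contains all of \<open>W\<^sub>x\<close>.
\<close>

lemma P_CRM_orthogonal:
  assumes s: "s \<in> (\<Inter>i\<in>{1..m}. U i)" and w: "w \<in> affine hull P_CRM_pts U m x"
  shows "(s - P_CRM U m x) \<bullet> (w - P_CRM U m x) = 0"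
proof -
  let ?p = "P_CRM U m x" and ?A = "P_CRM_pts U m x"
  let ?H = "{y. (s - ?p) \<bullet> y = (s - ?p) \<bullet> x}"
  have x: "x \<in> ?A" by (simp add: P_CRM_pts_def)
  have "?A \<subseteq> ?H"
  proof
    fix a assume a: "a \<in> ?A"
    have "dist s a = dist s x"
      using a affine_U s dist_set_reflection unfolding P_CRM_pts_def by blast
    then have "(dist s a)\<^sup>2 = (dist s x)\<^sup>2" "(dist ?p a)\<^sup>2 = (dist ?p x)\<^sup>2"
      using P_CRM_equidistant[OF a x] by simp_all
    \<comment> \<open>Subtracting the expanded identities cancels all quadratic terms and leaves an
      equation linear in \<open>a\<close>.\<close>
    then show "a \<in> ?H"
      by (simp add: dist_norm power2_norm_eq_inner inner_diff inner_commute algebra_simps)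
  qed
  then have "affine hull ?A \<subseteq> ?H" by (intro hull_minimal) (auto simp: affine_hyperplane)
  then have "w \<in> ?H" "?p \<in> ?H" using w P_CRM_in_hull by blast+
  then show ?thesis by (simp add: inner_diff_right)
qed

lemma closest_point_P_CRM:
  "closest_point (\<Inter>i\<in>{1..m}. U i) (P_CRM U m x) = closest_point (\<Inter>i\<in>{1..m}. U i) x"
proof (rule closest_point_affine_eqI)
  let ?S = "\<Inter>i\<in>{1..m}. U i" and ?p = "P_CRM U m x"
  let ?q = "closest_point ?S x"
  show S: "affine ?S" using affine_U by blast
  show q: "?q \<in> ?S"
    using Inter_nonempty affine_closed[OF S] by (rule closest_point_in_set[rotated])
  fix a assume a: "a \<in> ?S"
  have "x \<in> affine hull P_CRM_pts U m x" by (simp add: P_CRM_pts_def hull_inc)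
  then have "(a - ?p) \<bullet> (x - ?p) = 0" "(?q - ?p) \<bullet> (x - ?p) = 0"
    using P_CRM_orthogonal a q by blast+
  moreover have "(x - ?q) \<bullet> (a - ?q) = 0"
    using affine_closest_point_orthogonal[OF S a] .
  \<comment> \<open>The first two equations give \<open>(x - ?p) \<bullet> (a - ?q) = 0\<close>;
    subtract this from the third.\<close>
  ultimately show "(?p - ?q) \<bullet> (a - ?q) = 0"
    by (simp add: algebra_simps inner_commute)
qed

lemma P_CRM_dist_decrease:
  assumes s: "s \<in> (\<Inter>i\<in>{1..m}. U i)" and i: "i \<in> {1..m}"
  shows "(dist (P_CRM U m x) s)\<^sup>2 + (dist x (closest_point (U i) x))\<^sup>2 \<le> (dist x s)\<^sup>2"
proof -
  let ?p = "P_CRM U m x" and ?q = "closest_point (U i) x" and ?W = "affine hull P_CRM_pts U m x"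
  have "x \<in> ?W" "set_reflection (U i) x \<in> ?W"
    using i by (auto simp: P_CRM_pts_def intro!: hull_inc)
  \<comment> \<open>The midpoint of \<open>x\<close> and its reflection is the projection
    \<open>?q\<close>.\<close>
  then have "(1/2) *\<^sub>R x + (1/2) *\<^sub>R set_reflection (U i) x \<in> ?W"
    by (intro mem_affine) auto
  then have "?q \<in> ?W" by (simp add: set_reflection_def algebra_simps)
  then have "(s - ?p) \<bullet> (?q - ?p) = 0" by (rule P_CRM_orthogonal[OF s])
  then have "(dist ?q s)\<^sup>2 = (dist ?p s)\<^sup>2 + (dist ?q ?p)\<^sup>2"
    by (simp add: dist_norm power2_norm_eq_inner inner_diff inner_commute algebra_simps)
  moreover have "(dist x s)\<^sup>2 = (dist x ?q)\<^sup>2 + (dist ?q s)\<^sup>2"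
    using dist_affine_closest_point_Pythagoras[OF affine_U[OF i]] s i by blast
  ultimately show ?thesis by simp
qed

text \<open>The factor \<open>r\<close> is fixed before \<open>x\<close>, so one rate serves all
  points that project to \<open>s\<close>.\<close>

lemma P_CRM_contraction:
  assumes "m \<ge> 1" and s: "s \<in> (\<Inter>i\<in>{1..m}. U i)"
  shows "\<exists>r. 0 \<le> r \<and> r < 1 \<and> (\<forall>x. closest_point (\<Inter>i\<in>{1..m}. U i) x = s \<longrightarrow>
           norm (P_CRM U m x - s) \<le> r * norm (x - s))"
proof -
  let ?S = "\<Inter>i\<in>{1..m}. U i"
  have S: "affine ?S" using affine_U by blast
  obtain c where c: "c > 0" "\<And>v. \<forall>t\<in>?S. v \<bullet> (t - s) = 0 \<Longrightarrow>
      c * (norm v)\<^sup>2 \<le> (\<Sum>i\<in>{1..m}. (dist (s + v) (closest_point (U i) (s + v)))\<^sup>2)"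
    using affine_family_linear_regularity[of "{1..m}" U s] affine_U s by blast
  \<comment> \<open>Averaging the \<open>m\<close> decrease estimates gives the factor
    \<open>1 - c / m\<close> for squared norms. No upper bound on \<open>c\<close> is at hand, so
    \<open>max\<close> keeps the radicand nonnegative.\<close>
  define r where "r = sqrt (max 0 (1 - c / m))"
  have "norm (P_CRM U m x - s) \<le> r * norm (x - s)" if x: "closest_point ?S x = s" for x
  proof -
    have "\<forall>t\<in>?S. (x - s) \<bullet> (t - s) = 0"
      using affine_closest_point_orthogonal[OF S] x by blast
    then have "c * (norm (x - s))\<^sup>2 \<le> (\<Sum>i\<in>{1..m}. (dist x (closest_point (U i) x))\<^sup>2)"
      using c(2)[of "x - s"] by simp
    also have "\<dots> \<le> (\<Sum>i\<in>{1..m}. (dist x s)\<^sup>2 - (dist (P_CRM U m x) s)\<^sup>2)"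
      by (intro sum_mono) (use P_CRM_dist_decrease[OF s, of _ x] in \<open>simp add: algebra_simps\<close>)
    finally have "c * (norm (x - s))\<^sup>2 \<le> m * ((norm (x - s))\<^sup>2 - (norm (P_CRM U m x - s))\<^sup>2)"
      by (simp add: dist_norm)
    then have "(norm (P_CRM U m x - s))\<^sup>2 \<le> (1 - c / m) * (norm (x - s))\<^sup>2"
      using assms(1) by (simp add: field_simps)
    also have "\<dots> \<le> max 0 (1 - c / m) * (norm (x - s))\<^sup>2"
      by (intro mult_right_mono) auto
    also have "\<dots> = (r * norm (x - s))\<^sup>2"
      by (simp add: r_def power_mult_distrib)
    finally show ?thesis
      by (rule power2_le_imp_le) (simp add: r_def)
  qed
  moreover have "0 \<le> r" "r < 1" using c(1) assms(1) by (auto simp: r_def)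
  ultimately show ?thesis by blast
qed

end

theorem theorem3p6:
  fixes U :: "nat \<Rightarrow> (real ^ 'n) set" and m :: nat and x :: "real ^ 'n"
  assumes "m \<ge> 1"
    and "\<And>i. i \<in> {1..m} \<Longrightarrow> affine (U i)"
    and "(\<Inter>i\<in>{1..m}. U i) \<noteq> {}"
  shows "converges_linearly (\<lambda>k. (P_CRM U m ^^ k) x) (closest_point (\<Inter>i\<in>{1..m}. U i) x)"
proof -
  interpret affine_family U m by unfold_locales (use assms in auto)
  let ?S = "\<Inter>i\<in>{1..m}. U i"
  have "affine ?S" using assms(2) by blast
  then have "closest_point ?S x \<in> ?S"
    using assms(3) affine_closed closest_point_in_set by blast
  then obtain r where r: "0 \<le> r" "r < 1"
    "\<And>y. closest_point ?S y = closest_point ?S x \<Longrightarrow>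
      norm (P_CRM U m y - closest_point ?S x) \<le> r * norm (y - closest_point ?S x)"
    using P_CRM_contraction[OF assms(1)] by blast
  \<comment> \<open>Every iterate keeps the projection of \<open>x\<close>, so the estimate with the
    same \<open>r\<close> applies to each.\<close>
  have "closest_point ?S ((P_CRM U m ^^ k) x) = closest_point ?S x" for k
    by (induction k) (simp_all only: funpow.simps id_apply o_apply closest_point_P_CRM)
  from r(3)[OF this] r(1,2) show ?thesis
    unfolding converges_linearly_def funpow.simps o_apply by blast
qed

end
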